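(* Let $f$ be a positive regular free holomorphic function with $n$ indeterminates and let $m\ge1$, with $\mathbf D_f^m(\mathcal H)$ norm-closed and starlike. Let $H_1,\dots,H_n$ be formal power series in $n$ noncommuting indeterminates $Z_1,\dots,Z_n$ of the form $$H_i(Z_1,\dots,Z_n):=\sum_{k=2}^\infty\sum_{|\alpha|=k}a_\alpha^{(i)}Z_\alpha,\qquad a_\alpha^{(i)}\in\mathbb C,\ i=1,\dots,n.$$ If $$F(Z_1,\dots,Z_n):=(Z_1+H_1(Z_1,\dots,Z_n),\dots,Z_n+H_n(Z_1,\dots,Z_n))$$ has the property that $F(\mathbf D_{f,\mathrm{nil}}^m(\mathcal H))\subseteq\mathbf D_{f,\mathrm{nil}}^m(\mathcal H)$ for any Hilbert space $\mathcal H$, then $$F(Z_1,\dots,Z_n)=(Z_1,\dots,Z_n).$$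
   Context: $\mathbb F_n^+$ is the free monoid on generators $g_1,\dots,g_n$ with identity $g_0$; $|\alpha|$ is the length of $\alpha$. For $X\in B(\mathcal H)^n$ and $\alpha=g_{i_1}\cdots g_{i_k}$, $X_\alpha:=X_{i_1}\cdots X_{i_k}$, $X_{g_0}:=I$ (same for indeterminates $Z_i$). A positive regular free holomorphic function in $n$ indeterminates is a formal power series $f=\sum_{|\alpha|\ge1}a_\alpha X_\alpha$ with $a_\alpha\ge0$, $a_{g_i}>0$ for $i=1,\dots,n$, and $\limsup_{k\to\infty}(\sum_{|\alpha|=k}|a_\alpha|^2)^{1/2k}<\infty$. For $m\ge1$ and a Hilbert space $\mathcal H$, $$\mathbf D_f^m(\mathcal H):=\{X\in B(\mathcal H)^n:\ (id-\Phi_{f,X})^k(I)\ge0,\ 1\le k\le m\},\qquad \Phi_{f,X}(Y):=\sum_{k=1}^\infty\sum_{|\alpha|=k}a_\alpha X_\alpha YX_\alpha^*$$ (weak operator convergence). Standing assumption: $\mathbf D_f^m(\mathcal H)$ ($\mathcal H$ separable infinite dimensional) is closed in the operator norm and starlike ($r\mathbf D_f^m(\mathcal H)\subset\mathbf D_f^m(\mathcal H)$ for $r\in[0,1)$). A tuple $(N_1,\dots,N_n)\in B(\mathcal H)^n$ is nilpotent if there is $p\in\mathbb N=\{1,2,\dots\}$ with $N_\alpha=0$ for all $\alpha$ with $|\alpha|=p$. $\mathbf D_{f,\mathrm{nil}}^m(\mathcal H)$ is the set of nilpotent tuples in $\mathbf D_f^m(\mathcal H)$. A formal power series is evaluated at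 a nilpotent tuple by the resulting finite sum. *)

theory Defs
  imports
    "HOL-Analysis.Analysis"
    "HOL-Algebra.Module"
begin

section \<open>Hilbert spaces with an explicit carrier\<close>

text \<open>
  Complex Hilbert spaces are carrier-based structures rather than a type class, since
  the theorem quantifies over all Hilbert spaces inside one of its hypotheses. The record of
  HOL-Algebra modules also has fields for a ring multiplication and a unit on the vectors;
  they play no role here and are unconstrained.
\<close>

definition complex_ring :: "complex ring" where
  "complex_ring = \<lparr>carrier = UNIV, mult = (*), one = 1, zero = 0, add = (+)\<rparr>"

record 'a hilbert = "(complex, 'a) module" +
  hinner :: "'a \<Rightarrow> 'a \<Rightarrow> complex"

definition hnorm :: "('a, 'b) hilbert_scheme \<Rightarrow> 'a \<Rightarrow> real" where
  "hnorm H x = sqrt (Re (hinner H x x))"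

definition hdist :: "('a, 'b) hilbert_scheme \<Rightarrow> 'a \<Rightarrow> 'a \<Rightarrow> real" where
  "hdist H x y = hnorm H (x \<ominus>\<^bsub>H\<^esub> y)"

text \<open>The inner product is linear in its first argument.\<close>

locale hilbert_space = module complex_ring H for H :: "('a, 'b) hilbert_scheme" (structure) +
  assumes hinner_add_left:
      "\<lbrakk>x \<in> carrier H; y \<in> carrier H; z \<in> carrier H\<rbrakk>
        \<Longrightarrow> hinner H (x \<oplus> y) z = hinner H x z + hinner H y z"
    and hinner_smult_left:
      "\<lbrakk>x \<in> carrier H; y \<in> carrier H\<rbrakk> \<Longrightarrow> hinner H (c \<odot> x) y = c * hinner H x y"
    and hinner_commute:
      "\<lbrakk>x \<in> carrier H; y \<in> carrier H\<rbrakk> \<Longrightarrow> hinner H x y = cnj (hinner H y x)"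
    and hinner_nonneg: "x \<in> carrier H \<Longrightarrow> hinner H x x \<in> \<real>\<^sub>\<ge>\<^sub>0"
    and hinner_definite: "\<lbrakk>x \<in> carrier H; hinner H x x = 0\<rbrakk> \<Longrightarrow> x = \<zero>"
    and complete: "Metric_space.mcomplete (carrier H) (hdist H)"

definition separable_hilbert :: "('a, 'b) hilbert_scheme \<Rightarrow> bool" where
  "separable_hilbert H \<longleftrightarrow> separable_space (Metric_space.mtopology (carrier H) (hdist H))"

definition infinite_dimensional :: "('a, 'b) hilbert_scheme \<Rightarrow> bool" where
  "infinite_dimensional H \<longleftrightarrow>
    \<not> (\<exists>A. finite A \<and> A \<subseteq> carrier H \<and>
          (\<forall>x\<in>carrier H. \<exists>c. x = (\<Oplus>\<^bsub>H\<^esub>v\<in>A. c v \<odot>\<^bsub>H\<^esub> v)))"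


section \<open>Bounded operators\<close>

text \<open>
  Operators are extensional functions (undefined outside the carrier), so that HOL equality
  of operators is equality on the space.
\<close>

definition bounded_ops :: "('a, 'b) hilbert_scheme \<Rightarrow> ('a \<Rightarrow> 'a) set" where
  "bounded_ops H =
    {T \<in> carrier H \<rightarrow>\<^sub>E carrier H.
      (\<forall>x\<in>carrier H. \<forall>y\<in>carrier H. T (x \<oplus>\<^bsub>H\<^esub> y) = T x \<oplus>\<^bsub>H\<^esub> T y) \<and>
      (\<forall>c. \<forall>x\<in>carrier H. T (c \<odot>\<^bsub>H\<^esub> x) = c \<odot>\<^bsub>H\<^esub> T x) \<and>
      (\<exists>C. \<forall>x\<in>carrier H. hnorm H (T x) \<le> C * hnorm H x)}"

definition op_id :: "('a, 'b) hilbert_scheme \<Rightarrow> 'a \<Rightarrow> 'a" where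
  "op_id H = (\<lambda>x\<in>carrier H. x)"

definition op_zero :: "('a, 'b) hilbert_scheme \<Rightarrow> 'a \<Rightarrow> 'a" where
  "op_zero H = (\<lambda>x\<in>carrier H. \<zero>\<^bsub>H\<^esub>)"

definition op_diff :: "('a, 'b) hilbert_scheme \<Rightarrow> ('a \<Rightarrow> 'a) \<Rightarrow> ('a \<Rightarrow> 'a) \<Rightarrow> 'a \<Rightarrow> 'a" where
  "op_diff H S T = (\<lambda>x\<in>carrier H. S x \<ominus>\<^bsub>H\<^esub> T x)"

definition op_scale :: "('a, 'b) hilbert_scheme \<Rightarrow> complex \<Rightarrow> ('a \<Rightarrow> 'a) \<Rightarrow> 'a \<Rightarrow> 'a" where
  "op_scale H c T = (\<lambda>x\<in>carrier H. c \<odot>\<^bsub>H\<^esub> T x)"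

definition op_norm :: "('a, 'b) hilbert_scheme \<Rightarrow> ('a \<Rightarrow> 'a) \<Rightarrow> real" where
  "op_norm H T = (SUP x\<in>{x\<in>carrier H. hnorm H x \<le> 1}. hnorm H (T x))"

definition op_norm_topology :: "('a, 'b) hilbert_scheme \<Rightarrow> ('a \<Rightarrow> 'a) topology" where
  "op_norm_topology H =
    Metric_space.mtopology (bounded_ops H) (\<lambda>S T. op_norm H (op_diff H S T))"

definition adjoint_op :: "('a, 'b) hilbert_scheme \<Rightarrow> ('a \<Rightarrow> 'a) \<Rightarrow> 'a \<Rightarrow> 'a" where
  "adjoint_op H T =
    (THE S. S \<in> bounded_ops H \<and>
      (\<forall>x\<in>carrier H. \<forall>y\<in>carrier H. hinner H (T x) y = hinner H x (S y)))"

definition positive_op :: "('a, 'b) hilbert_scheme \<Rightarrow> ('a \<Rightarrow> 'a) \<Rightarrow> bool" where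
  "positive_op H T \<longleftrightarrow> T \<in> bounded_ops H \<and> (\<forall>x\<in>carrier H. hinner H (T x) x \<in> \<real>\<^sub>\<ge>\<^sub>0)"

definition wot_limit ::
    "('a, 'b) hilbert_scheme \<Rightarrow> (nat \<Rightarrow> 'a \<Rightarrow> 'a) \<Rightarrow> ('a \<Rightarrow> 'a) \<Rightarrow> bool" where
  "wot_limit H S T \<longleftrightarrow> T \<in> bounded_ops H \<and>
    (\<forall>x\<in>carrier H. \<forall>y\<in>carrier H. (\<lambda>K. hinner H (S K x) y) \<longlonglongrightarrow> hinner H (T x) y)"


section \<open>Words and formal power series in noncommuting indeterminates\<close>

text \<open>
  The index type \<open>'n\<close> enumerates the indeterminates, the free monoid on them is \<open>'n list\<close>,
  and a formal power series is its family of coefficients.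
\<close>

type_synonym ('n, 'c) power_series = "'n list \<Rightarrow> 'c"

definition indet :: "'n \<Rightarrow> ('n, complex) power_series" where
  "indet i = (\<lambda>\<alpha>. if \<alpha> = [i] then 1 else 0)"

primrec word_op :: "('a, 'b) hilbert_scheme \<Rightarrow> ('n \<Rightarrow> 'a \<Rightarrow> 'a) \<Rightarrow> 'n list \<Rightarrow> 'a \<Rightarrow> 'a" where
  "word_op H X [] = op_id H"
| "word_op H X (i # \<alpha>) = compose (carrier H) (X i) (word_op H X \<alpha>)"

definition nilpotent_tuple :: "('a, 'b) hilbert_scheme \<Rightarrow> ('n \<Rightarrow> 'a \<Rightarrow> 'a) \<Rightarrow> bool" where
  "nilpotent_tuple H X \<longleftrightarrow> (\<exists>p\<ge>1. \<forall>\<alpha>. length \<alpha> = p \<longrightarrow> word_op H X \<alpha> = op_zero H)"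

text \<open>
  Evaluation is meant for nilpotent tuples of finitely many operators: then only finitely
  many words have a nonzero value, and the sum below is finite.
\<close>

definition eval_nilpotent ::
    "('a, 'b) hilbert_scheme \<Rightarrow> ('n, complex) power_series \<Rightarrow> ('n \<Rightarrow> 'a \<Rightarrow> 'a) \<Rightarrow> 'a \<Rightarrow> 'a" where
  "eval_nilpotent H g X =
    (\<lambda>x\<in>carrier H. \<Oplus>\<^bsub>H\<^esub>\<alpha>\<in>{\<alpha>. word_op H X \<alpha> \<noteq> op_zero H}. g \<alpha> \<odot>\<^bsub>H\<^esub> word_op H X \<alpha> x)"


section \<open>Positive regular free holomorphic functions and their domains\<close>

definition positive_regular :: "('n::finite, real) power_series \<Rightarrow> bool" where
  "positive_regular f \<longleftrightarrow>
    f [] = 0 \<and> (\<forall>\<alpha>. 0 \<le> f \<alpha>) \<and> (\<forall>i. 0 < f [i]) \<and>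
    limsup (\<lambda>k. ereal (root (2 * k) (\<Sum>\<alpha> | length \<alpha> = k. \<bar>f \<alpha>\<bar>\<^sup>2))) < \<infinity>"

definition Phi_partial ::
    "('a, 'b) hilbert_scheme \<Rightarrow> ('n::finite, real) power_series \<Rightarrow> ('n \<Rightarrow> 'a \<Rightarrow> 'a)
      \<Rightarrow> ('a \<Rightarrow> 'a) \<Rightarrow> nat \<Rightarrow> 'a \<Rightarrow> 'a" where
  "Phi_partial H f X Y K =
    (\<lambda>x\<in>carrier H. \<Oplus>\<^bsub>H\<^esub>\<alpha>\<in>{\<alpha>. 1 \<le> length \<alpha> \<and> length \<alpha> \<le> K}.
      complex_of_real (f \<alpha>) \<odot>\<^bsub>H\<^esub> word_op H X \<alpha> (Y (adjoint_op H (word_op H X \<alpha>) x)))"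

definition Phi_converges ::
    "('a, 'b) hilbert_scheme \<Rightarrow> ('n::finite, real) power_series \<Rightarrow> ('n \<Rightarrow> 'a \<Rightarrow> 'a) \<Rightarrow> bool" where
  "Phi_converges H f X \<longleftrightarrow>
    (\<forall>Y\<in>bounded_ops H. \<exists>T. wot_limit H (Phi_partial H f X Y) T)"

definition Phi ::
    "('a, 'b) hilbert_scheme \<Rightarrow> ('n::finite, real) power_series \<Rightarrow> ('n \<Rightarrow> 'a \<Rightarrow> 'a)
      \<Rightarrow> ('a \<Rightarrow> 'a) \<Rightarrow> 'a \<Rightarrow> 'a" where
  "Phi H f X Y = (THE T. wot_limit H (Phi_partial H f X Y) T)"

text \<open>
  The inequalities presuppose that the series for \<open>Phi\<close> converges in the weak operator topology,
  which is therefore part of the definition of the domain.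
\<close>

definition domain_Dfm ::
    "('a, 'b) hilbert_scheme \<Rightarrow> ('n::finite, real) power_series \<Rightarrow> nat \<Rightarrow> ('n \<Rightarrow> 'a \<Rightarrow> 'a) set" where
  "domain_Dfm H f m =
    {X. (\<forall>i. X i \<in> bounded_ops H) \<and> Phi_converges H f X \<and>
        (\<forall>k. 1 \<le> k \<and> k \<le> m \<longrightarrow>
          positive_op H (((\<lambda>Y. op_diff H Y (Phi H f X Y)) ^^ k) (op_id H)))}"

definition domain_Dfm_nil ::
    "('a, 'b) hilbert_scheme \<Rightarrow> ('n::finite, real) power_series \<Rightarrow> nat \<Rightarrow> ('n \<Rightarrow> 'a \<Rightarrow> 'a) set" where
  "domain_Dfm_nil H f m = {X \<in> domain_Dfm H f m. nilpotent_tuple H X}"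

definition norm_closed_tuples :: "('a, 'b) hilbert_scheme \<Rightarrow> ('n \<Rightarrow> 'a \<Rightarrow> 'a) set \<Rightarrow> bool" where
  "norm_closed_tuples H D \<longleftrightarrow> closedin (product_topology (\<lambda>i. op_norm_topology H) UNIV) D"

definition starlike_tuples :: "('a, 'b) hilbert_scheme \<Rightarrow> ('n \<Rightarrow> 'a \<Rightarrow> 'a) set \<Rightarrow> bool" where
  "starlike_tuples H D \<longleftrightarrow>
    (\<forall>r::real. 0 \<le> r \<and> r < 1 \<longrightarrow> (\<forall>X\<in>D. (\<lambda>i. op_scale H (complex_of_real r) (X i)) \<in> D))"

end

theory Submission
  imports Defs
begin

text \<open>
  Suppose some coefficient \<open>a i \<alpha>\<close> is nonzero, and take \<open>\<alpha>\<close> of minimal length \<open>k \<ge> 2\<close>. On a space of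
  dimension \<open>k + 1\<close> let \<open>X\<close> be the shift along the letters of \<open>\<alpha>\<close>, scaled by \<open>r > 0\<close>. All words of
  length greater than \<open>k\<close> vanish at \<open>X\<close>, and \<open>\<alpha>\<close> is the only word of length \<open>k\<close> that does not, its
  value being \<open>r\<^sup>k\<close> times the corner matrix unit \<open>E\<close>. Hence \<open>F(X)\<^sub>i = X\<^sub>i + a i \<alpha> r\<^sup>k E\<close>, and since
  adding multiples of \<open>E\<close> does not change words of length at least 2, the \<open>t\<close>-th iterate of \<open>F\<close> is
  \<open>X\<^sub>i + t a i \<alpha> r\<^sup>k E\<close>. For small \<open>r\<close> the tuple \<open>X\<close> lies in the domain, so all iterates do; but
  \<open>\<Phi>(I) \<le> I\<close> bounds the rows of every operator in a tuple of the domain, which is absurd for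
  large \<open>t\<close>.
\<close>

section \<open>Finite-dimensional coordinate spaces\<close>

text \<open>
  The locale for metric spaces demands symmetry of the distance on the whole type. Cutting off
  sums at \<open>d\<close> gives this for \<open>hdist\<close> also outside the carrier.
\<close>

definition coord_space :: "nat \<Rightarrow> (nat \<Rightarrow> complex) hilbert" where
  "coord_space d =
    \<lparr>carrier = {x. \<forall>j\<ge>d. x j = 0}, mult = undefined, one = undefined,
     zero = (\<lambda>_. 0), add = (\<lambda>x y j. if j < d then x j + y j else 0), smult = (\<lambda>c x j. c * x j),
     hinner = (\<lambda>x y. \<Sum>j<d. x j * cnj (y j))\<rparr>"

lemma coord_space_simps [simp]:
  "carrier (coord_space d) = {x. \<forall>j\<ge>d. x j = 0}"
  "zero (coord_space d) = (\<lambda>_. 0)"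
  "add (coord_space d) = (\<lambda>x y j. if j < d then x j + y j else 0)"
  "smult (coord_space d) = (\<lambda>c x j. c * x j)"
  "hinner (coord_space d) = (\<lambda>x y. \<Sum>j<d. x j * cnj (y j))"
  by (simp_all add: coord_space_def)

lemma complex_ring_simps [simp]:
  "carrier complex_ring = UNIV" "mult complex_ring = (*)" "one complex_ring = 1"
  "zero complex_ring = 0" "add complex_ring = (+)"
  by (simp_all add: complex_ring_def)

lemma cring_complex_ring: "cring complex_ring"
  by (rule cringI, rule abelian_groupI, auto intro!: comm_monoidI exI[of _ "- _"]
      simp: algebra_simps intro: add.left_inverse)

lemma abelian_group_coord_space: "abelian_group (coord_space d)"
proof (rule abelian_groupI)
  fix x assume "x \<in> carrier (coord_space d)"
  then show "\<exists>y\<in>carrier (coord_space d). y \<oplus>\<^bsub>coord_space d\<^esub> x = \<zero>\<^bsub>coord_space d\<^esub>"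
    by (intro bexI[of _ "\<lambda>j. - x j"]) auto
qed (auto simp: algebra_simps)

lemma module_coord_space: "module complex_ring (coord_space d)"
  by (rule moduleI[OF cring_complex_ring abelian_group_coord_space])
     (auto simp: algebra_simps)

text \<open>Truncated addition reads only the coordinates below \<open>d\<close>, so even a sequence
  outside the carrier has exactly one additive inverse inside it. The formula therefore holds on the
  whole type, as symmetry of \<open>hdist\<close> demands.\<close>

lemma coord_space_minus:
  "x \<ominus>\<^bsub>coord_space d\<^esub> y = (\<lambda>j. if j < d then x j - y j else 0)"
proof -
  have "\<ominus>\<^bsub>coord_space d\<^esub> y = (\<lambda>j. if j < d then - y j else 0)"
    unfolding a_inv_def m_inv_def
  proof (rule the_equality)
    fix z assume "z \<in> carrier (add_monoid (coord_space d)) \<and>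
      y \<otimes>\<^bsub>add_monoid (coord_space d)\<^esub> z = \<one>\<^bsub>add_monoid (coord_space d)\<^esub> \<and>
      z \<otimes>\<^bsub>add_monoid (coord_space d)\<^esub> y = \<one>\<^bsub>add_monoid (coord_space d)\<^esub>"
    then show "z = (\<lambda>j. if j < d then - y j else 0)"
      by (auto simp: fun_eq_iff eq_neg_iff_add_eq_0 split: if_splits)
  qed auto
  then show ?thesis by (auto simp: a_minus_def)
qed

lemma coord_space_finsum:
  assumes "finite A" "\<And>a. a \<in> A \<Longrightarrow> g a \<in> carrier (coord_space d)"
  shows "finsum (coord_space d) g A = (\<lambda>j. \<Sum>a\<in>A. g a j)"
proof -
  interpret abelian_group "coord_space d" by (rule abelian_group_coord_space)
  show ?thesis using assms
  proof (induction A rule: finite_induct)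
    case empty
    then show ?case by (simp add: finsum_empty)
  next
    case (insert a A)
    then show ?case by (subst finsum_insert) auto
  qed
qed

section \<open>Norm, distance and completeness of the coordinate spaces\<close>

lemma coord_space_hinner_self:
  "hinner (coord_space d) x x = complex_of_real (\<Sum>j<d. (cmod (x j))\<^sup>2)"
  by (simp only: coord_space_simps of_real_sum complex_norm_square)

lemma coord_space_hnorm: "hnorm (coord_space d) x = L2_set (\<lambda>j. cmod (x j)) {..<d}"
  by (simp only: hnorm_def coord_space_hinner_self L2_set_def Re_complex_of_real)

lemma coord_space_hdist:
  "hdist (coord_space d) x y = L2_set (\<lambda>j. cmod (x j - y j)) {..<d}"
  unfolding hdist_def coord_space_minus coord_space_hnorm by (rule L2_set_cong) auto

lemma Metric_space_coord_space:
  "Metric_space (carrier (coord_space d)) (hdist (coord_space d))"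
proof
  fix x y z :: "nat \<Rightarrow> complex"
  show "0 \<le> hdist (coord_space d) x y"
    by (simp add: coord_space_hdist)
  show "hdist (coord_space d) x y = hdist (coord_space d) y x"
    by (simp add: coord_space_hdist norm_minus_commute)
  show "hdist (coord_space d) x z \<le> hdist (coord_space d) x y + hdist (coord_space d) y z"
    unfolding coord_space_hdist
    by (rule order_trans[OF L2_set_mono L2_set_triangle_ineq])
       (auto intro: order_trans[OF _ norm_triangle_ineq])
  assume "x \<in> carrier (coord_space d)" "y \<in> carrier (coord_space d)"
  then have "x = y \<longleftrightarrow> (\<forall>j<d. x j = y j)"
    by (auto simp: fun_eq_iff) (metis leI)
  then show "hdist (coord_space d) x y = 0 \<longleftrightarrow> x = y"
    by (auto simp: coord_space_hdist L2_set_eq_0_iff)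
qed

text \<open>Each coordinate is dominated by the Euclidean norm, so Cauchy sequences converge
  coordinatewise; since only \<open>d\<close> coordinates enter the distance, this is already
  convergence in norm.\<close>

lemma mcomplete_coord_space:
  "Metric_space.mcomplete (carrier (coord_space d)) (hdist (coord_space d))"
proof -
  interpret Metric_space "carrier (coord_space d)" "hdist (coord_space d)"
    by (rule Metric_space_coord_space)
  show ?thesis unfolding mcomplete_def
  proof (intro allI impI)
    fix s assume s: "MCauchy s"
    then have carr: "s n \<in> carrier (coord_space d)" for n
      unfolding MCauchy_def by blast
    have "Cauchy (\<lambda>n. s n j)" for j
    proof (cases "j < d")
      case True
      show ?thesis
      proof (rule metric_CauchyI)
        fix e :: real assume "e > 0"
        with s obtain N where N: "\<And>n n'. N \<le> n \<Longrightarrow> N \<le> n' \<Longrightarrow>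
            L2_set (\<lambda>j. cmod (s n j - s n' j)) {..<d} < e"
          unfolding MCauchy_def coord_space_hdist by meson
        have "dist (s n j) (s n' j) \<le> L2_set (\<lambda>j. cmod (s n j - s n' j)) {..<d}" for n n'
          unfolding dist_norm by (rule member_le_L2_set) (simp_all add: True)
        with N show "\<exists>N. \<forall>n\<ge>N. \<forall>n'\<ge>N. dist (s n j) (s n' j) < e"
          by (meson le_less_trans)
      qed
    next
      case False
      then have "s n j = 0" for n using carr by simp
      then show ?thesis by (simp add: Cauchy_def)
    qed
    then have "\<exists>l. (\<lambda>n. s n j) \<longlonglongrightarrow> l" for j
      using Cauchy_convergent_iff convergent_def by blast
    then obtain x where x: "\<And>j. (\<lambda>n. s n j) \<longlonglongrightarrow> x j" by metis
    have "x j = 0" if "j \<ge> d" for j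
    proof -
      have "s n j = 0" for n using carr that by simp
      then show ?thesis using x[of j] by (simp add: LIMSEQ_const_iff)
    qed
    moreover have "(\<lambda>n. L2_set (\<lambda>j. cmod (s n j - x j)) {..<d}) \<longlonglongrightarrow> L2_set (\<lambda>j. cmod (x j - x j)) {..<d}"
      unfolding L2_set_def by (intro tendsto_intros x)
    then have "(\<lambda>n. L2_set (\<lambda>j. cmod (s n j - x j)) {..<d}) \<longlonglongrightarrow> 0"
      by (simp add: L2_set_def)
    ultimately have "limitin mtopology s x sequentially"
      unfolding limitin_metric_dist_null coord_space_hdist using carr by simp
    then show "\<exists>x. limitin mtopology s x sequentially" by (rule exI[of _ x])
  qed
qed

text \<open>Makes the hypothesis \<open>self_map\<close> applicable to the finite-dimensional spaces
  on which the shifts act.\<close>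

lemma hilbert_space_coord_space: "hilbert_space (coord_space d)"
proof (rule hilbert_space.intro[OF module_coord_space], unfold_locales)
  fix x y assume "x \<in> carrier (coord_space d)" "y \<in> carrier (coord_space d)"
  show "hinner (coord_space d) x y = cnj (hinner (coord_space d) y x)"
    by (simp add: mult.commute)
next
  fix x assume x: "x \<in> carrier (coord_space d)"
  show "hinner (coord_space d) x x \<in> \<real>\<^sub>\<ge>\<^sub>0"
    unfolding coord_space_hinner_self by (simp add: sum_nonneg del: of_real_sum)
  assume "hinner (coord_space d) x x = 0"
  then have "(\<Sum>j<d. (cmod (x j))\<^sup>2) = 0"
    unfolding coord_space_hinner_self by (simp del: of_real_sum)
  then have "x j = 0" if "j < d" for j
    using that by (simp add: sum_nonneg_eq_0_iff)
  with x show "x = \<zero>\<^bsub>coord_space d\<^esub>"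
    by (auto intro!: ext) (metis leI)
qed (auto simp: algebra_simps sum.distrib sum_distrib_left mcomplete_coord_space[simplified])

section \<open>Operators as matrices\<close>

text \<open>Restriction to the carrier makes the operator extensional, as members of
  \<open>bounded_ops\<close> must be. Only entries with both indices below \<open>d\<close> count,
  so matrices may be given by formulas on all pairs of naturals.\<close>

definition mat_op :: "nat \<Rightarrow> (nat \<Rightarrow> nat \<Rightarrow> complex) \<Rightarrow> (nat \<Rightarrow> complex) \<Rightarrow> nat \<Rightarrow> complex" where
  "mat_op d M = (\<lambda>x\<in>carrier (coord_space d). \<lambda>j. if j < d then \<Sum>l<d. M j l * x l else 0)"

definition unit_vec :: "nat \<Rightarrow> nat \<Rightarrow> complex" where
  "unit_vec l = (\<lambda>j. if j = l then 1 else 0)"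

lemma unit_vec_carrier [simp]: "l < d \<Longrightarrow> unit_vec l \<in> carrier (coord_space d)"
  by (simp add: unit_vec_def)

lemma mat_op_apply:
  "x \<in> carrier (coord_space d) \<Longrightarrow>
    mat_op d M x = (\<lambda>j. if j < d then \<Sum>l<d. M j l * x l else 0)"
  by (simp add: mat_op_def)

lemma restrict_eq_mat_op:
  "(\<And>x. x \<in> carrier (coord_space d) \<Longrightarrow> g x = mat_op d M x) \<Longrightarrow>
    restrict g (carrier (coord_space d)) = mat_op d M"
  unfolding mat_op_def by (rule restrict_ext) simp

lemma mat_op_carrier:
  "x \<in> carrier (coord_space d) \<Longrightarrow> mat_op d M x \<in> carrier (coord_space d)"
  by (simp add: mat_op_def)

lemma mat_op_unit_vec:
  "j < d \<Longrightarrow> l < d \<Longrightarrow> mat_op d M (unit_vec l) j = M j l"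
  by (subst mat_op_apply[OF unit_vec_carrier]) (simp_all add: unit_vec_def if_distrib cong: if_cong)

lemma hinner_unit_vec_left:
  "j < d \<Longrightarrow> hinner (coord_space d) (unit_vec j) y = cnj (y j)"
  by (simp add: unit_vec_def if_distrib[of "\<lambda>t. t * _"] cong: if_cong)

lemma hinner_unit_vec_right:
  "j < d \<Longrightarrow> hinner (coord_space d) x (unit_vec j) = x j"
  by (simp add: unit_vec_def if_distrib cong: if_cong)

lemma mat_op_cong:
  "(\<And>j l. j < d \<Longrightarrow> l < d \<Longrightarrow> M j l = N j l) \<Longrightarrow> mat_op d M = mat_op d N"
  unfolding mat_op_def by (intro ext restrict_ext if_cong refl sum.cong) auto

lemma mat_op_eq_iff:
  "mat_op d M = mat_op d N \<longleftrightarrow> (\<forall>j<d. \<forall>l<d. M j l = N j l)"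
  using mat_op_cong[of d M N] mat_op_unit_vec[of _ d _ M] mat_op_unit_vec[of _ d _ N] by metis

lemma op_id_coord_space: "op_id (coord_space d) = mat_op d (\<lambda>j l. if l = j then 1 else 0)"
  unfolding op_id_def mat_op_def
  by (rule restrict_ext) (auto simp: if_distrib[of "\<lambda>t. t * _"] cong: if_cong)

lemma op_zero_coord_space: "op_zero (coord_space d) = mat_op d (\<lambda>j l. 0)"
  unfolding op_zero_def mat_op_def by (rule restrict_ext) auto

lemma op_diff_mat_op:
  "op_diff (coord_space d) (mat_op d M) (mat_op d N) = mat_op d (\<lambda>j l. M j l - N j l)"
  unfolding op_diff_def coord_space_minus
  by (auto simp: mat_op_def algebra_simps sum_subtractf intro!: restrict_ext)

lemma compose_mat_op:
  "compose (carrier (coord_space d)) (mat_op d M) (mat_op d N) =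
    mat_op d (\<lambda>j l. \<Sum>p<d. M j p * N p l)"
proof -
  have "mat_op d M (mat_op d N x) = mat_op d (\<lambda>j l. \<Sum>p<d. M j p * N p l) x"
    if x: "x \<in> carrier (coord_space d)" for x
  proof -
    have "(\<Sum>p<d. M j p * (\<Sum>l<d. N p l * x l)) = (\<Sum>l<d. (\<Sum>p<d. M j p * N p l) * x l)" for j
      unfolding sum_distrib_left sum_distrib_right mult.assoc by (rule sum.swap)
    then show ?thesis
      by (subst mat_op_apply[OF mat_op_carrier[OF x]]) (simp add: mat_op_apply[OF x] cong: if_cong)
  qed
  then show ?thesis
    unfolding compose_def by (rule restrict_eq_mat_op)
qed

text \<open>The sum of the moduli of all entries serves as a crude bound.\<close>

lemma mat_op_bounded: "mat_op d M \<in> bounded_ops (coord_space d)"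
proof -
  let ?H = "coord_space d"
  have "hnorm ?H (mat_op d M x) \<le> (\<Sum>j<d. \<Sum>l<d. cmod (M j l)) * hnorm ?H x"
    if x: "x \<in> carrier ?H" for x
  proof -
    have xl: "cmod (x l) \<le> hnorm ?H x" if "l < d" for l
      unfolding coord_space_hnorm by (rule member_le_L2_set) (simp_all add: that)
    have "hnorm ?H (mat_op d M x) \<le> (\<Sum>j<d. cmod (mat_op d M x j))"
      unfolding coord_space_hnorm by (rule L2_set_le_sum) auto
    also have "\<dots> \<le> (\<Sum>j<d. (\<Sum>l<d. cmod (M j l)) * hnorm ?H x)"
    proof (rule sum_mono)
      fix j assume "j \<in> {..<d}"
      then have "cmod (mat_op d M x j) \<le> (\<Sum>l<d. cmod (M j l * x l))"
        by (simp add: mat_op_apply[OF x] norm_sum)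
      also have "\<dots> \<le> (\<Sum>l<d. cmod (M j l) * hnorm ?H x)"
        by (intro sum_mono) (auto simp: norm_mult intro!: mult_left_mono xl)
      finally show "cmod (mat_op d M x j) \<le> (\<Sum>l<d. cmod (M j l)) * hnorm ?H x"
        by (simp add: sum_distrib_right)
    qed
    finally show ?thesis by (simp add: sum_distrib_right)
  qed
  moreover have "mat_op d M \<in> carrier ?H \<rightarrow>\<^sub>E carrier ?H"
    by (auto simp: mat_op_def)
  moreover have "mat_op d M (x \<oplus>\<^bsub>?H\<^esub> y) = mat_op d M x \<oplus>\<^bsub>?H\<^esub> mat_op d M y"
    if "x \<in> carrier ?H" "y \<in> carrier ?H" for x y
    using that by (auto simp: mat_op_def algebra_simps sum.distrib cong: if_cong)
  moreover have "mat_op d M (c \<odot>\<^bsub>?H\<^esub> x) = c \<odot>\<^bsub>?H\<^esub> mat_op d M x" if "x \<in> carrier ?H" for x c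
    using that by (auto simp: mat_op_def sum_distrib_left mult.left_commute)
  ultimately show ?thesis unfolding bounded_ops_def by blast
qed

text \<open>A linear map is determined by its values on the unit vectors, which are the columns of
  its matrix. Statements about \<open>bounded_ops\<close> thereby reduce to matrices.\<close>

lemma bounded_op_coord_space:
  assumes "T \<in> bounded_ops (coord_space d)"
  shows "T = mat_op d (\<lambda>j l. T (unit_vec l) j)"
proof -
  let ?H = "coord_space d"
  interpret module complex_ring ?H by (rule module_coord_space)
  have T: "T \<in> carrier ?H \<rightarrow>\<^sub>E carrier ?H"
    and add: "\<And>x y. x \<in> carrier ?H \<Longrightarrow> y \<in> carrier ?H \<Longrightarrow> T (x \<oplus>\<^bsub>?H\<^esub> y) = T x \<oplus>\<^bsub>?H\<^esub> T y"
    and smult: "\<And>c x. x \<in> carrier ?H \<Longrightarrow> T (c \<odot>\<^bsub>?H\<^esub> x) = c \<odot>\<^bsub>?H\<^esub> T x"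
    using assms unfolding bounded_ops_def by blast+
  \<comment> \<open>Truncating \<open>x\<close> after \<open>n\<close> coordinates turns the
    expansion in unit vectors into an induction on \<open>n\<close>, which reaches \<open>x\<close>
    itself at \<open>n = d\<close>.\<close>
  have step: "T (\<lambda>j. if j < n then x j else 0) = (\<lambda>j. \<Sum>l<n. T (unit_vec l) j * x l)"
    if x: "x \<in> carrier ?H" and n: "n \<le> d" for x n
    using n
  proof (induction n)
    case 0
    have "T \<zero>\<^bsub>?H\<^esub> = T (0 \<odot>\<^bsub>?H\<^esub> \<zero>\<^bsub>?H\<^esub>)" by simp
    also have "\<dots> = 0 \<odot>\<^bsub>?H\<^esub> T \<zero>\<^bsub>?H\<^esub>" by (rule smult) simp
    finally show ?case by simp
  next
    case (Suc n)
    have unit: "unit_vec n \<in> carrier ?H" by (rule unit_vec_carrier) (use Suc.prems in simp)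
    \<comment> \<open>Addition in the space erases coordinates from \<open>d\<close> on, while the
      plain sum in the claim does not; the two agree because \<open>T\<close> maps into the
      carrier.\<close>
    have vanish: "T (unit_vec l) j = 0" if "l < Suc n" "\<not> j < d" for l j
    proof -
      have "T (unit_vec l) \<in> carrier ?H"
        using T unit_vec_carrier[of l d] Suc.prems that by auto
      then show ?thesis using that by simp
    qed
    let ?y = "\<lambda>j. if j < n then x j else 0"
    have y: "?y \<in> carrier ?H" using Suc.prems by simp
    have "(\<lambda>j. if j < Suc n then x j else 0) = ?y \<oplus>\<^bsub>?H\<^esub> (x n \<odot>\<^bsub>?H\<^esub> unit_vec n)"
      using Suc.prems by (auto simp: unit_vec_def fun_eq_iff less_Suc_eq)
    then have "T (\<lambda>j. if j < Suc n then x j else 0) = T ?y \<oplus>\<^bsub>?H\<^esub> (x n \<odot>\<^bsub>?H\<^esub> T (unit_vec n))"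
      by (simp only: add[OF y smult_closed[OF _ unit]] smult[OF unit] complex_ring_simps UNIV_I)
    moreover have "T ?y = (\<lambda>j. \<Sum>l<n. T (unit_vec l) j * x l)"
      by (rule Suc.IH) (use Suc.prems in simp)
    ultimately show ?case
      by (simp only: coord_space_simps) (rule ext, simp add: mult.commute vanish)
  qed
  have "T x = mat_op d (\<lambda>j l. T (unit_vec l) j) x" if x: "x \<in> carrier ?H" for x
  proof -
    have "x = (\<lambda>j. if j < d then x j else 0)" using x by (auto simp: fun_eq_iff)
    then have "T x = (\<lambda>j. \<Sum>l<d. T (unit_vec l) j * x l)" using step[OF x, of d] by simp
    moreover have "T x \<in> carrier ?H" using T x by blast
    ultimately show ?thesis by (auto simp: mat_op_apply[OF x] fun_eq_iff)
  qed
  moreover have "mat_op d (\<lambda>j l. T (unit_vec l) j) \<in> extensional (carrier ?H)"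
    by (simp add: mat_op_def)
  moreover have "T \<in> extensional (carrier ?H)" using T by (simp add: PiE_def)
  ultimately show ?thesis by (meson extensionalityI)
qed

text \<open>The adjoint is a definite description, so uniqueness is needed too: any candidate is
  bounded, hence a matrix, and testing on unit vectors fixes its entries.\<close>

lemma adjoint_mat_op:
  "adjoint_op (coord_space d) (mat_op d M) = mat_op d (\<lambda>j l. cnj (M l j))"
  unfolding adjoint_op_def
proof (rule the_equality)
  let ?H = "coord_space d"
  have adj: "hinner ?H (mat_op d M x) y = hinner ?H x (mat_op d (\<lambda>j l. cnj (M l j)) y)"
    if x: "x \<in> carrier ?H" and y: "y \<in> carrier ?H" for x y
  proof -
    have "(\<Sum>j<d. (\<Sum>l<d. M j l * x l) * cnj (y j)) = (\<Sum>l<d. x l * (\<Sum>j<d. M j l * cnj (y j)))"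
      unfolding sum_distrib_left sum_distrib_right
      by (subst sum.swap) (simp add: mult_ac)
    then show ?thesis
      by (simp add: mat_op_apply[OF x] mat_op_apply[OF y])
  qed
  then show "mat_op d (\<lambda>j l. cnj (M l j)) \<in> bounded_ops ?H \<and>
      (\<forall>x\<in>carrier ?H. \<forall>y\<in>carrier ?H.
        hinner ?H (mat_op d M x) y = hinner ?H x (mat_op d (\<lambda>j l. cnj (M l j)) y))"
    using mat_op_bounded by blast
  fix S assume S: "S \<in> bounded_ops ?H \<and>
      (\<forall>x\<in>carrier ?H. \<forall>y\<in>carrier ?H. hinner ?H (mat_op d M x) y = hinner ?H x (S y))"
  have "S (unit_vec l) j = cnj (M l j)" if "j < d" "l < d" for j l
  proof -
    have "hinner ?H (mat_op d M (unit_vec j)) (unit_vec l) = hinner ?H (unit_vec j) (S (unit_vec l))"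
      using S that unit_vec_carrier by blast
    then show ?thesis
      unfolding hinner_unit_vec_left[OF that(1)] hinner_unit_vec_right[OF that(2)]
      by (simp add: mat_op_unit_vec that)
  qed
  then have "mat_op d (\<lambda>j l. S (unit_vec l) j) = mat_op d (\<lambda>j l. cnj (M l j))"
    by (intro mat_op_cong) auto
  with S show "S = mat_op d (\<lambda>j l. cnj (M l j))"
    using bounded_op_coord_space by metis
qed

lemma mat_op_mat_op:
  "x \<in> carrier (coord_space d) \<Longrightarrow>
    mat_op d M (mat_op d N x) = mat_op d (\<lambda>j l. \<Sum>p<d. M j p * N p l) x"
  by (metis compose_eq compose_mat_op)

section \<open>The map \<open>\<Phi>\<close> on matrices\<close>

text \<open>Testing against unit vectors recovers matrix entries, whose limits are unique. This
  resolves the definite description in \<open>Phi\<close>.\<close>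

lemma wot_limit_coord_space_unique:
  assumes "wot_limit (coord_space d) S T" "wot_limit (coord_space d) S T'"
  shows "T = T'"
proof -
  let ?H = "coord_space d"
  have "T (unit_vec l) j = T' (unit_vec l) j" if "j < d" "l < d" for j l
  proof (rule LIMSEQ_unique)
    have "(\<lambda>K. hinner ?H (S K (unit_vec l)) (unit_vec j)) \<longlonglongrightarrow> hinner ?H (T (unit_vec l)) (unit_vec j)"
      "(\<lambda>K. hinner ?H (S K (unit_vec l)) (unit_vec j)) \<longlonglongrightarrow> hinner ?H (T' (unit_vec l)) (unit_vec j)"
      using assms that unit_vec_carrier unfolding wot_limit_def by blast+
    then show "(\<lambda>K. S K (unit_vec l) j) \<longlonglongrightarrow> T (unit_vec l) j"
      "(\<lambda>K. S K (unit_vec l) j) \<longlonglongrightarrow> T' (unit_vec l) j"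
      unfolding hinner_unit_vec_right[OF that(1)] .
  qed
  then have "mat_op d (\<lambda>j l. T (unit_vec l) j) = mat_op d (\<lambda>j l. T' (unit_vec l) j)"
    by (intro mat_op_cong) auto
  then show ?thesis
    using assms bounded_op_coord_space[of T d] bounded_op_coord_space[of T' d]
    unfolding wot_limit_def by metis
qed

lemma finite_words_le: "finite {\<beta> :: 'n::finite list. P \<beta> \<and> length \<beta> \<le> K}"
  by (rule finite_subset[OF _ finite_lists_length_le[of UNIV K]]) auto

text \<open>An entry of the partial sum of \<open>\<Phi>\<close>: each summand is the product of the
  matrix of the word, \<open>Y\<close>, and the conjugate transpose of the matrix of the
  word.\<close>

definition Phi_mat ::
    "nat \<Rightarrow> ('n::finite, real) power_series \<Rightarrow> ('n list \<Rightarrow> nat \<Rightarrow> nat \<Rightarrow> complex)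
      \<Rightarrow> (nat \<Rightarrow> nat \<Rightarrow> complex) \<Rightarrow> nat \<Rightarrow> nat \<Rightarrow> nat \<Rightarrow> complex" where
  "Phi_mat d f W Y K j l =
    (\<Sum>\<beta> | 1 \<le> length \<beta> \<and> length \<beta> \<le> K.
      complex_of_real (f \<beta>) * (\<Sum>p<d. \<Sum>q<d. W \<beta> j p * Y p q * cnj (W \<beta> l q)))"

lemma Phi_partial_mat_op:
  assumes W: "\<And>\<beta>. word_op (coord_space d) X \<beta> = mat_op d (W \<beta>)"
  shows "Phi_partial (coord_space d) f X (mat_op d Y) K = mat_op d (Phi_mat d f W Y K)"
proof -
  let ?H = "coord_space d" and ?B = "{\<beta> :: 'a list. 1 \<le> length \<beta> \<and> length \<beta> \<le> K}"
  let ?M = "\<lambda>\<beta> j l. \<Sum>p<d. \<Sum>q<d. W \<beta> j p * Y p q * cnj (W \<beta> l q)"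
  have "(\<Oplus>\<^bsub>?H\<^esub>\<beta>\<in>?B. complex_of_real (f \<beta>) \<odot>\<^bsub>?H\<^esub>
      word_op ?H X \<beta> (mat_op d Y (adjoint_op ?H (word_op ?H X \<beta>) x))) =
      mat_op d (Phi_mat d f W Y K) x" if x: "x \<in> carrier ?H" for x
  proof -
    have "mat_op d (W \<beta>) (mat_op d Y (adjoint_op ?H (mat_op d (W \<beta>)) x)) = mat_op d (?M \<beta>) x" for \<beta>
      unfolding adjoint_mat_op mat_op_mat_op[OF x] mat_op_mat_op[OF mat_op_carrier[OF x]]
      by (simp only: sum_distrib_left mult.assoc)
    then have "(\<Oplus>\<^bsub>?H\<^esub>\<beta>\<in>?B. complex_of_real (f \<beta>) \<odot>\<^bsub>?H\<^esub>
        word_op ?H X \<beta> (mat_op d Y (adjoint_op ?H (word_op ?H X \<beta>) x))) =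
        (\<Oplus>\<^bsub>?H\<^esub>\<beta>\<in>?B. complex_of_real (f \<beta>) \<odot>\<^bsub>?H\<^esub> mat_op d (?M \<beta>) x)"
      by (simp only: W)
    also have "\<dots> = (\<lambda>j. \<Sum>\<beta>\<in>?B. (complex_of_real (f \<beta>) \<odot>\<^bsub>?H\<^esub> mat_op d (?M \<beta>) x) j)"
      by (rule coord_space_finsum[OF finite_words_le])
         (use mat_op_carrier[OF x] in simp)
    also have "\<dots> = mat_op d (Phi_mat d f W Y K) x"
    proof
      fix j :: nat
      have swap: "(\<Sum>\<beta>\<in>?B. complex_of_real (f \<beta>) * (\<Sum>l<d. M \<beta> j l * x l)) =
          (\<Sum>l<d. (\<Sum>\<beta>\<in>?B. complex_of_real (f \<beta>) * M \<beta> j l) * x l)" for M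
        unfolding sum_distrib_left sum_distrib_right mult.assoc by (rule sum.swap)
      have "(\<Sum>\<beta>\<in>?B. complex_of_real (f \<beta>) * (\<Sum>l<d. ?M \<beta> j l * x l)) =
          (\<Sum>l<d. Phi_mat d f W Y K j l * x l)"
        unfolding Phi_mat_def by (rule swap)
      then show "(\<Sum>\<beta>\<in>?B. (complex_of_real (f \<beta>) \<odot>\<^bsub>?H\<^esub> mat_op d (?M \<beta>) x) j) =
          mat_op d (Phi_mat d f W Y K) x j"
        by (simp add: mat_op_apply[OF x])
    qed
    finally show ?thesis .
  qed
  then show ?thesis
    unfolding Phi_partial_def by (rule restrict_eq_mat_op)
qed

text \<open>Words of length at least \<open>d\<close> have zero matrices, so the partial sums are
  constant from \<open>K = d\<close> on.\<close>

lemma wot_limit_Phi_partial_mat_op: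
  assumes W: "\<And>\<beta>. word_op (coord_space d) X \<beta> = mat_op d (W \<beta>)"
    and nil: "\<And>\<beta> j l. d \<le> length \<beta> \<Longrightarrow> j < d \<Longrightarrow> l < d \<Longrightarrow> W \<beta> j l = 0"
  shows "wot_limit (coord_space d) (Phi_partial (coord_space d) f X (mat_op d Y))
    (mat_op d (Phi_mat d f W Y d))"
proof -
  have "mat_op d (Phi_mat d f W Y K) = mat_op d (Phi_mat d f W Y d)" if "d \<le> K" for K
  proof (rule mat_op_cong)
    fix j l assume "j < d" "l < d"
    then have "(\<Sum>p<d. \<Sum>q<d. W \<beta> j p * Y p q * cnj (W \<beta> l q)) = 0" if "\<not> length \<beta> \<le> d" for \<beta>
      using that by (simp add: nil)
    then show "Phi_mat d f W Y K j l = Phi_mat d f W Y d j l"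
      unfolding Phi_mat_def using that
      by (intro sum.mono_neutral_right finite_words_le) auto
  qed
  then have "\<forall>\<^sub>F K in sequentially. Phi_partial (coord_space d) f X (mat_op d Y) K =
      mat_op d (Phi_mat d f W Y d)"
    unfolding Phi_partial_mat_op[OF W] eventually_sequentially by blast
  then show ?thesis
    unfolding wot_limit_def using mat_op_bounded
    by (auto intro!: tendsto_eventually elim!: eventually_mono simp del: coord_space_simps)
qed

text \<open>Every bounded operator here is a matrix, so the limit for matrices covers all
  \<open>Y\<close>.\<close>

lemma Phi_converges_mat_op:
  assumes "\<And>\<beta>. word_op (coord_space d) X \<beta> = mat_op d (W \<beta>)"
    and "\<And>\<beta> j l. d \<le> length \<beta> \<Longrightarrow> j < d \<Longrightarrow> l < d \<Longrightarrow> W \<beta> j l = 0"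
  shows "Phi_converges (coord_space d) f X"
  unfolding Phi_converges_def
  using wot_limit_Phi_partial_mat_op[where W = W, OF assms] bounded_op_coord_space by metis

lemma Phi_mat_op:
  assumes "\<And>\<beta>. word_op (coord_space d) X \<beta> = mat_op d (W \<beta>)"
    and "\<And>\<beta> j l. d \<le> length \<beta> \<Longrightarrow> j < d \<Longrightarrow> l < d \<Longrightarrow> W \<beta> j l = 0"
  shows "Phi (coord_space d) f X (mat_op d Y) = mat_op d (Phi_mat d f W Y d)"
  unfolding Phi_def
  using wot_limit_Phi_partial_mat_op[where W = W, OF assms] wot_limit_coord_space_unique
  by (intro the_equality) blast+

text \<open>The diagonal entry of \<open>I - \<Phi>(I)\<close> at \<open>j\<close> is nonnegative,
  and that of \<open>\<Phi>(I)\<close> is the sum over words of \<open>f \<beta>\<close> times the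
  squared norm of row \<open>j\<close>. Keeping only the word \<open>[i]\<close> gives the
  bound.\<close>

lemma domain_row_bound:
  assumes W: "\<And>\<beta>. word_op (coord_space d) X \<beta> = mat_op d (W \<beta>)"
    and nil: "\<And>\<beta> j l. d \<le> length \<beta> \<Longrightarrow> j < d \<Longrightarrow> l < d \<Longrightarrow> W \<beta> j l = 0"
    and f: "\<And>\<beta>. 0 \<le> f \<beta>" and m: "1 \<le> m" and X: "X \<in> domain_Dfm (coord_space d) f m"
    and j: "j < d"
  shows "f [i] * (\<Sum>p<d. (cmod (W [i] j p))\<^sup>2) \<le> 1"
proof -
  let ?H = "coord_space d" and ?B = "{\<beta> :: 'a list. 1 \<le> length \<beta> \<and> length \<beta> \<le> d}"
  let ?I = "\<lambda>j l :: nat. if l = j then 1 else 0 :: complex"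
  have "positive_op ?H (((\<lambda>Y. op_diff ?H Y (Phi ?H f X Y)) ^^ 1) (op_id ?H))"
    using X m unfolding domain_Dfm_def by blast
  then have "positive_op ?H (mat_op d (\<lambda>j l. ?I j l - Phi_mat d f W ?I d j l))"
    by (simp add: op_id_coord_space Phi_mat_op[where W = W, OF W nil] op_diff_mat_op)
  then have "hinner ?H (mat_op d (\<lambda>j l. ?I j l - Phi_mat d f W ?I d j l) (unit_vec j)) (unit_vec j)
      \<in> \<real>\<^sub>\<ge>\<^sub>0"
    using unit_vec_carrier[OF j] unfolding positive_op_def by blast
  then have "1 - Phi_mat d f W ?I d j j \<in> \<real>\<^sub>\<ge>\<^sub>0"
    unfolding hinner_unit_vec_right[OF j] mat_op_unit_vec[OF j j] by simp
  moreover have "Phi_mat d f W ?I d j j =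
      complex_of_real (\<Sum>\<beta>\<in>?B. f \<beta> * (\<Sum>p<d. (cmod (W \<beta> j p))\<^sup>2))"
    unfolding Phi_mat_def of_real_sum of_real_mult
    by (intro sum.cong refl arg_cong2[of _ _ _ _ "(*)"])
       (simp add: if_distrib if_distribR flip: complex_norm_square cong: if_cong)
  ultimately have "(\<Sum>\<beta>\<in>?B. f \<beta> * (\<Sum>p<d. (cmod (W \<beta> j p))\<^sup>2)) \<le> 1"
    by (simp add: complex_nonneg_Reals_iff del: of_real_sum)
  \<comment> \<open>\<open>[i]\<close> is an index in \<open>?B\<close>, since \<open>j < d\<close>
    gives \<open>1 \<le> d\<close>; the other summands are nonnegative.\<close>
  moreover have "f [i] * (\<Sum>p<d. (cmod (W [i] j p))\<^sup>2) \<le>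
      (\<Sum>\<beta>\<in>?B. f \<beta> * (\<Sum>p<d. (cmod (W \<beta> j p))\<^sup>2))"
    by (rule member_le_sum) (use j f in \<open>auto simp: sum_nonneg intro: finite_words_le\<close>)
  ultimately show ?thesis by linarith
qed

section \<open>The shift along a word\<close>

text \<open>
  The matrices of the words in the weighted shift along the letters of \<open>\<alpha>\<close>, that is
  \<open>X\<^sub>i e\<^sub>j\<^sub>+\<^sub>1 = r e\<^sub>j\<close> if the letter of \<open>\<alpha>\<close> at position \<open>j\<close> is \<open>i\<close>, perturbed by \<open>c i\<close> in the corner
  entry.
\<close>

definition path_mat ::
    "'n list \<Rightarrow> real \<Rightarrow> ('n \<Rightarrow> complex) \<Rightarrow> 'n list \<Rightarrow> nat \<Rightarrow> nat \<Rightarrow> complex" where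
  "path_mat \<alpha> r c \<beta> j l =
    (if l = j + length \<beta> \<and> take (length \<beta>) (drop j \<alpha>) = \<beta> then complex_of_real (r ^ length \<beta>) else 0) +
    (if length \<beta> = 1 \<and> j = 0 \<and> l = length \<alpha> then c (hd \<beta>) else 0)"

definition path_tuple ::
    "'n list \<Rightarrow> real \<Rightarrow> ('n \<Rightarrow> complex) \<Rightarrow> 'n \<Rightarrow> (nat \<Rightarrow> complex) \<Rightarrow> nat \<Rightarrow> complex" where
  "path_tuple \<alpha> r c i = mat_op (Suc (length \<alpha>)) (path_mat \<alpha> r c [i])"

lemma take_drop_eq_Cons_iff:
  "take (Suc n) (drop j \<alpha>) = i # \<beta> \<longleftrightarrow>
    j < length \<alpha> \<and> \<alpha> ! j = i \<and> take n (drop (Suc j) \<alpha>) = \<beta>"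
proof (cases "j < length \<alpha>")
  case True
  then show ?thesis by (simp add: Cons_nth_drop_Suc[symmetric])
qed simp

text \<open>The corner perturbations cancel out of products. In the left factor the corner leads to
  row \<open>length \<alpha>\<close> of the right factor, which is zero; in the right factor the
  corner lies in row \<open>0\<close>, whereas the shift leads only to rows
  \<open>Suc j\<close>.\<close>

lemma path_mat_Cons:
  assumes "2 \<le> length \<alpha>" "j < Suc (length \<alpha>)" "l < Suc (length \<alpha>)" "\<beta> \<noteq> []"
  shows "(\<Sum>p<Suc (length \<alpha>). path_mat \<alpha> r c [i] j p * path_mat \<alpha> r c \<beta> p l) =
    path_mat \<alpha> r c (i # \<beta>) j l"
proof -
  let ?d = "Suc (length \<alpha>)"
  let ?s = "if j < length \<alpha> \<and> \<alpha> ! j = i then complex_of_real r else 0"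
  have last: "path_mat \<alpha> r c \<beta> (length \<alpha>) l = 0"
    using assms by (auto simp: path_mat_def)
  have letter: "path_mat \<alpha> r c [i] j p =
      (if p = Suc j then ?s else 0) + (if j = 0 \<and> p = length \<alpha> then c i else 0)" for p
    using take_drop_eq_Cons_iff[of 0 j \<alpha> i "[]"] by (simp add: path_mat_def)
  have "path_mat \<alpha> r c [i] j p * path_mat \<alpha> r c \<beta> p l =
      (if p = Suc j then ?s * path_mat \<alpha> r c \<beta> (Suc j) l else 0)" for p
    unfolding letter distrib_right using last assms(1) by auto
  then have "(\<Sum>p<?d. path_mat \<alpha> r c [i] j p * path_mat \<alpha> r c \<beta> p l) =
      ?s * path_mat \<alpha> r c \<beta> (Suc j) l"
    by (simp add: sum.delta del: sum.lessThan_Suc)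
  moreover have "path_mat \<alpha> r c \<beta> (Suc j) l =
      (if l = Suc j + length \<beta> \<and> take (length \<beta>) (drop (Suc j) \<alpha>) = \<beta>
        then complex_of_real (r ^ length \<beta>) else 0)"
    by (simp add: path_mat_def)
  moreover have "path_mat \<alpha> r c (i # \<beta>) j l =
      (if l = Suc j + length \<beta> \<and> j < length \<alpha> \<and> \<alpha> ! j = i \<and> take (length \<beta>) (drop (Suc j) \<alpha>) = \<beta>
        then complex_of_real (r ^ Suc (length \<beta>)) else 0)"
    using assms(4) take_drop_eq_Cons_iff[of "length \<beta>" j \<alpha> i \<beta>] by (simp add: path_mat_def)
  ultimately show ?thesis by simp
qed

lemma word_op_path_tuple:
  assumes "2 \<le> length \<alpha>"
  shows "word_op (coord_space (Suc (length \<alpha>))) (path_tuple \<alpha> r c) \<beta> =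
    mat_op (Suc (length \<alpha>)) (path_mat \<alpha> r c \<beta>)"
proof (induction \<beta>)
  case Nil
  show ?case
    unfolding word_op.simps op_id_coord_space by (rule mat_op_cong) (simp add: path_mat_def)
next
  case (Cons i \<beta>)
  let ?d = "Suc (length \<alpha>)"
  have "(\<Sum>p<?d. path_mat \<alpha> r c [i] j p * path_mat \<alpha> r c \<beta> p l) = path_mat \<alpha> r c (i # \<beta>) j l"
    if "j < ?d" "l < ?d" for j l
  \<comment> \<open>The empty word is separate: its matrix is the identity, whose last row is not
    zero.\<close>
  proof (cases "\<beta> = []")
    case True
    have "path_mat \<alpha> r c [i] j p * path_mat \<alpha> r c [] p l =
        (if p = l then path_mat \<alpha> r c [i] j l else 0)" for p
      by (simp add: path_mat_def[of _ _ _ "[]"])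
    then show ?thesis using True that by (simp add: sum.delta del: sum.lessThan_Suc)
  next
    case False
    show ?thesis by (rule path_mat_Cons[OF assms that False])
  qed
  then have "mat_op ?d (\<lambda>j l. \<Sum>p<?d. path_mat \<alpha> r c [i] j p * path_mat \<alpha> r c \<beta> p l) =
      mat_op ?d (path_mat \<alpha> r c (i # \<beta>))"
    by (rule mat_op_cong)
  then show ?case
    unfolding word_op.simps Cons.IH unfolding path_tuple_def compose_mat_op .
qed

text \<open>A step of this length leaves the index range, and the corner term occurs only for single
  letters.\<close>

lemma path_mat_long:
  assumes "2 \<le> length \<alpha>" "Suc (length \<alpha>) \<le> length \<beta>" "j < Suc (length \<alpha>)" "l < Suc (length \<alpha>)"
  shows "path_mat \<alpha> r c \<beta> j l = 0"
  using assms by (auto simp: path_mat_def)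

lemma nilpotent_path_tuple:
  assumes "2 \<le> length \<alpha>"
  shows "nilpotent_tuple (coord_space (Suc (length \<alpha>))) (path_tuple \<alpha> r c)"
proof -
  have "word_op (coord_space (Suc (length \<alpha>))) (path_tuple \<alpha> r c) \<beta> =
      op_zero (coord_space (Suc (length \<alpha>)))" if "length \<beta> = Suc (length \<alpha>)" for \<beta>
    unfolding word_op_path_tuple[OF assms] op_zero_coord_space
    by (rule mat_op_cong) (rule path_mat_long[OF assms], use that in simp_all)
  then show ?thesis unfolding nilpotent_tuple_def by (intro exI[of _ "Suc (length \<alpha>)"]) simp
qed

text \<open>Words shorter than \<open>\<alpha>\<close> contribute only the letter \<open>i\<close>.
  Among the remaining words only \<open>\<alpha>\<close> has a nonzero matrix, namely
  \<open>r ^ length \<alpha>\<close> in the corner.\<close>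

lemma eval_nilpotent_path_tuple:
  fixes g :: "('n::finite, complex) power_series"
  assumes \<alpha>: "2 \<le> length \<alpha>"
    and g: "\<And>\<beta>. length \<beta> < length \<alpha> \<Longrightarrow> g \<beta> = indet i \<beta>"
  shows "eval_nilpotent (coord_space (Suc (length \<alpha>))) g (path_tuple \<alpha> r c) =
    mat_op (Suc (length \<alpha>)) (path_mat \<alpha> r (\<lambda>i. c i + g \<alpha> * complex_of_real (r ^ length \<alpha>)) [i])"
proof -
  let ?d = "Suc (length \<alpha>)"
  let ?H = "coord_space ?d"
  let ?W = "path_mat \<alpha> r c"
  define A where "A = {\<beta> :: 'n list. mat_op ?d (?W \<beta>) \<noteq> op_zero ?H}"
  have sub: "A \<subseteq> {\<beta>. True \<and> length \<beta> \<le> ?d}"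
  proof
    fix \<beta> assume "\<beta> \<in> A"
    then obtain j l where "j < ?d" "l < ?d" "?W \<beta> j l \<noteq> 0"
      unfolding A_def op_zero_coord_space mat_op_eq_iff by auto
    then show "\<beta> \<in> {\<beta>. True \<and> length \<beta> \<le> ?d}"
      using path_mat_long[OF \<alpha>, of \<beta> j l r c] by (cases "?d \<le> length \<beta>") auto
  qed
  have fin: "finite A" by (rule finite_subset[OF sub finite_words_le])
  have entry: "(\<Sum>\<beta>\<in>A. g \<beta> * ?W \<beta> j l) =
      path_mat \<alpha> r (\<lambda>i. c i + g \<alpha> * complex_of_real (r ^ length \<alpha>)) [i] j l"
    if j: "j < ?d" and l: "l < ?d" for j l
  proof -
    have zero: "?W \<beta> j l = 0" if "\<beta> \<notin> A" for \<beta>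
      using that j l unfolding A_def op_zero_coord_space mat_op_eq_iff by blast
    have other: "g \<beta> * ?W \<beta> j l = 0" if "\<beta> \<noteq> [i]" "\<beta> \<noteq> \<alpha>" for \<beta>
    proof (cases "length \<beta> < length \<alpha>")
      case True
      then show ?thesis using g that by (simp add: indet_def)
    next
      case False
      \<comment> \<open>A factor of \<open>\<alpha>\<close> at least as long as
        \<open>\<alpha>\<close> starts at position \<open>0\<close> and is \<open>\<alpha>\<close>
        itself.\<close>
      have neg: "\<not> (l = j + length \<beta> \<and> take (length \<beta>) (drop j \<alpha>) = \<beta>)"
      proof
        assume *: "l = j + length \<beta> \<and> take (length \<beta>) (drop j \<alpha>) = \<beta>"
        with False l have "j = 0" "length \<beta> = length \<alpha>" by linarith+
        with * \<open>\<beta> \<noteq> \<alpha>\<close> show False by simp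
      qed
      show ?thesis unfolding path_mat_def if_not_P[OF neg] using False \<alpha> by simp
    qed
    have "[i] \<noteq> \<alpha>" using \<alpha> by auto
    \<comment> \<open>\<open>A\<close> may miss \<open>[i]\<close>, for instance if the letter
      \<open>i\<close> is absent from \<open>\<alpha>\<close> and \<open>c i = 0\<close>. Hence the
      index set is first enlarged by zero terms and then cut down to the two relevant words.\<close>
    have "(\<Sum>\<beta>\<in>A. g \<beta> * ?W \<beta> j l) = (\<Sum>\<beta>\<in>A \<union> {[i], \<alpha>}. g \<beta> * ?W \<beta> j l)"
      by (rule sum.mono_neutral_left) (use fin zero in auto)
    also have "\<dots> = (\<Sum>\<beta>\<in>{[i], \<alpha>}. g \<beta> * ?W \<beta> j l)"
      by (rule sum.mono_neutral_right) (use fin other in auto)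
    also have "\<dots> = ?W [i] j l + g \<alpha> * ?W \<alpha> j l"
      using \<open>[i] \<noteq> \<alpha>\<close> g[of "[i]"] \<alpha> by (simp add: indet_def)
    also have "\<dots> = path_mat \<alpha> r (\<lambda>i. c i + g \<alpha> * complex_of_real (r ^ length \<alpha>)) [i] j l"
      using \<alpha> j l by (auto simp: path_mat_def)
    finally show ?thesis .
  qed
  show ?thesis
    unfolding eval_nilpotent_def word_op_path_tuple[OF \<alpha>] A_def[symmetric]
  proof (rule restrict_eq_mat_op)
    fix x assume x: "x \<in> carrier ?H"
    have "(\<Oplus>\<^bsub>?H\<^esub>\<beta>\<in>A. g \<beta> \<odot>\<^bsub>?H\<^esub> mat_op ?d (?W \<beta>) x) =
        (\<lambda>j. \<Sum>\<beta>\<in>A. (g \<beta> \<odot>\<^bsub>?H\<^esub> mat_op ?d (?W \<beta>) x) j)"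
      by (rule coord_space_finsum[OF fin]) (use mat_op_carrier[OF x] in simp)
    also have "\<dots> = (\<lambda>j. if j < ?d then \<Sum>l<?d. (\<Sum>\<beta>\<in>A. g \<beta> * ?W \<beta> j l) * x l else 0)"
    proof
      fix j :: nat
      have "(\<Sum>\<beta>\<in>A. g \<beta> * (\<Sum>l<?d. ?W \<beta> j l * x l)) = (\<Sum>l<?d. (\<Sum>\<beta>\<in>A. g \<beta> * ?W \<beta> j l) * x l)"
        unfolding sum_distrib_left sum_distrib_right mult.assoc by (rule sum.swap)
      then show "(\<Sum>\<beta>\<in>A. (g \<beta> \<odot>\<^bsub>?H\<^esub> mat_op ?d (?W \<beta>) x) j) =
          (if j < ?d then \<Sum>l<?d. (\<Sum>\<beta>\<in>A. g \<beta> * ?W \<beta> j l) * x l else 0)"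
        unfolding mat_op_apply[OF x] by (simp del: sum.lessThan_Suc)
    qed
    also have "\<dots> = mat_op ?d (path_mat \<alpha> r (\<lambda>i. c i + g \<alpha> * complex_of_real (r ^ length \<alpha>)) [i]) x"
      unfolding mat_op_apply[OF x]
      by (intro ext if_cong refl sum.cong arg_cong2[of _ _ _ _ "(*)"] entry) auto
    finally show "(\<Oplus>\<^bsub>?H\<^esub>\<beta>\<in>A. g \<beta> \<odot>\<^bsub>?H\<^esub> mat_op ?d (?W \<beta>) x) = \<dots>" .
  qed
qed

section \<open>Membership of small shifts in the domain\<close>

text \<open>The diagonal entries of \<open>(id - \<Phi>)^s (I)\<close> at the unperturbed shift. The
  length bound is the dimension, where the series for \<open>\<Phi>\<close> has stabilised.\<close>

primrec diag_iter ::
    "('n::finite, real) power_series \<Rightarrow> 'n list \<Rightarrow> real \<Rightarrow> nat \<Rightarrow> nat \<Rightarrow> real" where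
  "diag_iter f \<alpha> r 0 = (\<lambda>j. 1)"
| "diag_iter f \<alpha> r (Suc s) = (\<lambda>j. diag_iter f \<alpha> r s j -
    (\<Sum>\<beta> | 1 \<le> length \<beta> \<and> length \<beta> \<le> Suc (length \<alpha>).
      f \<beta> * (if take (length \<beta>) (drop j \<alpha>) = \<beta>
        then r ^ (2 * length \<beta>) * diag_iter f \<alpha> r s (j + length \<beta>) else 0)))"

text \<open>Each of the finitely many correction terms carries a positive power of \<open>r\<close>,
  while the other factor stays convergent by induction.\<close>

lemma tendsto_diag_iter: "((\<lambda>r. diag_iter f \<alpha> r s j) \<longlongrightarrow> 1) (at_right 0)"
proof (induction s arbitrary: j)
  case 0
  show ?case by simp
next
  case (Suc s)
  have summand: "((\<lambda>r. f \<beta> * (if take (length \<beta>) (drop j \<alpha>) = \<beta>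
      then r ^ (2 * length \<beta>) * diag_iter f \<alpha> r s (j + length \<beta>) else 0)) \<longlongrightarrow> 0) (at_right 0)"
    if "\<beta> \<noteq> []" for \<beta>
  proof -
    have "((\<lambda>r. r ^ (2 * length \<beta>) * diag_iter f \<alpha> r s (j + length \<beta>)) \<longlongrightarrow> 0 ^ (2 * length \<beta>) * 1)
        (at_right (0::real))"
      by (rule tendsto_mult[OF tendsto_power[OF tendsto_ident_at] Suc])
    moreover have "0 ^ (2 * length \<beta>) * 1 = (0::real)" using that by simp
    ultimately have "((\<lambda>r. r ^ (2 * length \<beta>) * diag_iter f \<alpha> r s (j + length \<beta>)) \<longlongrightarrow> 0) (at_right 0)"
      by (simp only:)
    then show ?thesis
      by (cases "take (length \<beta>) (drop j \<alpha>) = \<beta>") (simp_all add: tendsto_mult_right_zero)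
  qed
  have "((\<lambda>r. diag_iter f \<alpha> r (Suc s) j) \<longlongrightarrow>
      1 - (\<Sum>\<beta> :: 'a list | 1 \<le> length \<beta> \<and> length \<beta> \<le> Suc (length \<alpha>). 0)) (at_right 0)"
    unfolding diag_iter.simps by (rule tendsto_diff[OF Suc tendsto_sum], rule summand) auto
  then show ?case by simp
qed

lemma positive_diag_op:
  assumes "\<And>j. j < d \<Longrightarrow> 0 \<le> \<delta> j"
  shows "positive_op (coord_space d) (mat_op d (\<lambda>j l. if l = j then complex_of_real (\<delta> j) else 0))"
proof -
  have "hinner (coord_space d) (mat_op d (\<lambda>j l. if l = j then complex_of_real (\<delta> j) else 0) x) x =
      complex_of_real (\<Sum>j<d. \<delta> j * (cmod (x j))\<^sup>2)" if x: "x \<in> carrier (coord_space d)" for x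
    unfolding mat_op_apply[OF x] of_real_sum of_real_mult complex_norm_square
    by (simp add: if_distrib[of "\<lambda>t. t * _"] mult.assoc cong: if_cong)
  moreover have "0 \<le> (\<Sum>j<d. \<delta> j * (cmod (x j))\<^sup>2)" for x :: "nat \<Rightarrow> complex"
    using assms by (intro sum_nonneg) auto
  ultimately show ?thesis
    unfolding positive_op_def
    by (intro conjI ballI mat_op_bounded) (simp only: nonneg_Reals_of_real_iff)
qed

text \<open>Without perturbation, row \<open>j\<close> of a word's matrix has at most one nonzero
  entry, in column \<open>j + length \<beta>\<close>, and that column has no other nonzero entry.
  Conjugation therefore keeps diagonal matrices diagonal.\<close>

lemma path_mat_conj_diag:
  assumes j: "j < Suc (length \<alpha>)"
  shows "(\<Sum>p<Suc (length \<alpha>). \<Sum>q<Suc (length \<alpha>). path_mat \<alpha> r (\<lambda>_. 0) \<beta> j p *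
      (if q = p then complex_of_real (\<delta> p) else 0) * cnj (path_mat \<alpha> r (\<lambda>_. 0) \<beta> l q)) =
    (if l = j then complex_of_real (if take (length \<beta>) (drop j \<alpha>) = \<beta>
      then r ^ (2 * length \<beta>) * \<delta> (j + length \<beta>) else 0) else 0)"
proof (cases "take (length \<beta>) (drop j \<alpha>) = \<beta>")
  case False
  then have "path_mat \<alpha> r (\<lambda>_. 0) \<beta> j p = 0" for p by (simp add: path_mat_def)
  then show ?thesis by (simp only: False mult_zero_left sum.neutral_const if_False of_real_0 if_cancel)
next
  case True
  let ?d = "Suc (length \<alpha>)" and ?W = "path_mat \<alpha> r (\<lambda>_. 0) \<beta>" and ?n = "length \<beta>"
  \<comment> \<open>Comparing lengths in the case assumption shows that \<open>\<beta>\<close> fits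
    into \<open>\<alpha>\<close> from position \<open>j\<close>, so \<open>j + ?n\<close> is a valid
    index.\<close>
  have "min (length \<alpha> - j) ?n = ?n" using arg_cong[OF True, of length] by simp
  then have n: "j + ?n < ?d" using j by linarith
  have row: "?W j p = (if p = j + ?n then complex_of_real (r ^ ?n) else 0)" for p
    by (simp add: path_mat_def True)
  have col: "?W l (j + ?n) = (if l = j then complex_of_real (r ^ ?n) else 0)"
    by (auto simp: path_mat_def True)
  have "(\<Sum>q<?d. ?W j p * (if q = p then complex_of_real (\<delta> p) else 0) * cnj (?W l q)) =
      (if p = j + ?n then complex_of_real (r ^ ?n * \<delta> p) * cnj (?W l p) else 0)" if "p < ?d" for p
  proof -
    have "?W j p * (if q = p then complex_of_real (\<delta> p) else 0) * cnj (?W l q) =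
        (if q = p then ?W j p * complex_of_real (\<delta> p) * cnj (?W l p) else 0)" for q
      by simp
    then show ?thesis using that by (simp add: sum.delta row del: sum.lessThan_Suc)
  qed
  then have "(\<Sum>p<?d. \<Sum>q<?d. ?W j p * (if q = p then complex_of_real (\<delta> p) else 0) * cnj (?W l q)) =
      (\<Sum>p<?d. if p = j + ?n then complex_of_real (r ^ ?n * \<delta> p) * cnj (?W l p) else 0)"
    by (intro sum.cong) auto
  also have "\<dots> = complex_of_real (r ^ ?n * \<delta> (j + ?n)) * cnj (?W l (j + ?n))"
    using n by (simp add: sum.delta del: sum.lessThan_Suc)
  finally show ?thesis by (simp add: col True mult_2 power_add)
qed

text \<open>At \<open>r = 0\<close> all the iterates would be the identity, so they stay positive for small \<open>r\<close>.\<close>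

lemma path_tuple_in_domain:
  assumes \<alpha>: "2 \<le> length \<alpha>"
  shows "\<exists>r>0. path_tuple \<alpha> r (\<lambda>_. 0) \<in> domain_Dfm (coord_space (Suc (length \<alpha>))) f m"
proof -
  let ?d = "Suc (length \<alpha>)"
  let ?H = "coord_space ?d"
  \<comment> \<open>These are finitely many conditions, each true near \<open>0\<close> since the
    limit is \<open>1\<close>; one \<open>r\<close> serves them all.\<close>
  have "\<forall>\<^sub>F r in at_right 0. \<forall>s\<in>{..m}. \<forall>j\<in>{..<?d}. 0 < diag_iter f \<alpha> r s j"
    by (intro eventually_ball_finite ballI order_tendstoD[OF tendsto_diag_iter]) auto
  moreover have "\<forall>\<^sub>F r::real in at_right 0. 0 < r"
    by (simp add: eventually_at_right_less)
  ultimately have "\<forall>\<^sub>F r::real in at_right 0. 0 < r \<and> (\<forall>s\<in>{..m}. \<forall>j\<in>{..<?d}. 0 < diag_iter f \<alpha> r s j)"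
    by eventually_elim blast
  from eventually_happens'[OF trivial_limit_at_right_real this] obtain r :: real where r: "r > 0"
    and pos: "\<And>s j. s \<le> m \<Longrightarrow> j < ?d \<Longrightarrow> 0 < diag_iter f \<alpha> r s j"
    by blast
  let ?X = "path_tuple \<alpha> r (\<lambda>_. 0)" and ?W = "path_mat \<alpha> r (\<lambda>_. 0)"
  have W: "word_op ?H ?X \<beta> = mat_op ?d (?W \<beta>)" for \<beta>
    by (rule word_op_path_tuple[OF \<alpha>])
  have nil: "?W \<beta> j l = 0" if "?d \<le> length \<beta>" "j < ?d" "l < ?d" for \<beta> j l
    by (rule path_mat_long[OF \<alpha> that])
  have iter: "((\<lambda>Y. op_diff ?H Y (Phi ?H f ?X Y)) ^^ s) (op_id ?H) =
      mat_op ?d (\<lambda>j l. if l = j then complex_of_real (diag_iter f \<alpha> r s j) else 0)" for s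
  proof (induction s)
    case 0
    show ?case by (simp add: op_id_coord_space cong: if_cong)
  next
    case (Suc s)
    let ?D = "\<lambda>j l. if l = j then complex_of_real (diag_iter f \<alpha> r s j) else 0"
    have "Phi_mat ?d f ?W ?D ?d j l = (if l = j then complex_of_real
        (\<Sum>\<beta> | 1 \<le> length \<beta> \<and> length \<beta> \<le> ?d. f \<beta> * (if take (length \<beta>) (drop j \<alpha>) = \<beta>
          then r ^ (2 * length \<beta>) * diag_iter f \<alpha> r s (j + length \<beta>) else 0)) else 0)"
      if j: "j < ?d" and l: "l < ?d" for j l
    proof -
      have summand: "complex_of_real (f \<beta>) * (\<Sum>p<?d. \<Sum>q<?d. ?W \<beta> j p * ?D p q * cnj (?W \<beta> l q)) =
          (if l = j then complex_of_real (f \<beta> * (if take (length \<beta>) (drop j \<alpha>) = \<beta>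
            then r ^ (2 * length \<beta>) * diag_iter f \<alpha> r s (j + length \<beta>) else 0)) else 0)"
        for \<beta> :: "'a list"
        unfolding path_mat_conj_diag[OF j] by simp
      show ?thesis
        unfolding Phi_mat_def summand
        by (cases "l = j") (simp_all only: of_real_sum simp_thms if_True if_False sum.neutral_const)
    qed
    then have "mat_op ?d (\<lambda>j l. ?D j l - Phi_mat ?d f ?W ?D ?d j l) =
        mat_op ?d (\<lambda>j l. if l = j then complex_of_real (diag_iter f \<alpha> r (Suc s) j) else 0)"
      by (intro mat_op_cong) simp
    then show ?case
      by (simp only: funpow.simps o_apply Suc Phi_mat_op[where W = ?W, OF W nil] op_diff_mat_op)
  qed
  have "?X \<in> domain_Dfm ?H f m"
    unfolding domain_Dfm_def mem_Collect_eq iter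
  proof (intro conjI allI impI)
    show "?X i \<in> bounded_ops ?H" for i
      unfolding path_tuple_def by (rule mat_op_bounded)
    show "Phi_converges ?H f ?X"
      by (rule Phi_converges_mat_op[where W = ?W, OF W nil])
    show "positive_op ?H (mat_op ?d (\<lambda>j l. if l = j then complex_of_real (diag_iter f \<alpha> r s j) else 0))"
      if "1 \<le> s \<and> s \<le> m" for s
      using that pos by (intro positive_diag_op) (simp add: less_imp_le)
  qed
  with r show ?thesis by blast
qed

section \<open>Iterating the self-map\<close>

theorem theorem4p1:
  fixes f :: "('n::finite, real) power_series"
    and m :: nat
    and K :: "'k hilbert"
    and a :: "'n \<Rightarrow> ('n, complex) power_series"
    and F :: "'n \<Rightarrow> ('n, complex) power_series"
  assumes f: "positive_regular f"
    and m: "1 \<le> m"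
    and K: "hilbert_space K" "separable_hilbert K" "infinite_dimensional K"
    and closed: "norm_closed_tuples K (domain_Dfm K f m)"
    and starlike: "starlike_tuples K (domain_Dfm K f m)"
    and a: "\<And>i \<alpha>. length \<alpha> < 2 \<Longrightarrow> a i \<alpha> = 0"
    and F: "\<And>i. F i = (\<lambda>\<alpha>. indet i \<alpha> + a i \<alpha>)"
    \<comment> \<open>Every Hilbert space of dimension at most the continuum has a unitarily equivalent copy
      carried by a set of complex sequences; restricting the hypothesis to these makes the
      theorem at least as strong as the one for arbitrary Hilbert spaces.\<close>
    and self_map: "\<And>H :: (nat \<Rightarrow> complex) hilbert. hilbert_space H \<Longrightarrow>
      (\<lambda>N i. eval_nilpotent H (F i) N) ` domain_Dfm_nil H f m \<subseteq> domain_Dfm_nil H f m"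
  shows "F = indet"
proof -
  have f_nonneg: "0 \<le> f \<beta>" and f_pos: "0 < f [i]" for \<beta> i
    using f unfolding positive_regular_def by auto
  \<comment> \<open>Induction on the length, for all \<open>i\<close> at once, plays the role of
    choosing a shortest word: below \<open>length \<alpha>\<close> every \<open>F i\<close> agrees
    with \<open>indet i\<close>.\<close>
  have "a i \<alpha> = 0" for i \<alpha>
  proof (induction \<alpha> arbitrary: i rule: length_induct)
    case (1 \<alpha> i)
    show ?case
    proof (cases "length \<alpha> < 2")
      case False
      then have \<alpha>: "2 \<le> length \<alpha>" by simp
      let ?d = "Suc (length \<alpha>)"
      let ?H = "coord_space ?d"
      obtain r where r: "r > 0" and X0: "path_tuple \<alpha> r (\<lambda>_. 0) \<in> domain_Dfm ?H f m"
        using path_tuple_in_domain[OF \<alpha>] by blast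
      \<comment> \<open>The corner entries after \<open>t\<close> applications of \<open>F\<close>:
        each application adds the same amount, since words of length at least 2 ignore the
        corner.\<close>
      define c where "c = (\<lambda>t i. of_nat t * (a i \<alpha> * complex_of_real (r ^ length \<alpha>)))"
      have coeff: "F i \<beta> = indet i \<beta>" if "length \<beta> < length \<alpha>" for \<beta> i
        using 1 that by (simp add: F)
      have F\<alpha>: "F i \<alpha> = a i \<alpha>" for i
        using \<alpha> by (auto simp: F indet_def)
      have step: "(\<lambda>i. eval_nilpotent ?H (F i) (path_tuple \<alpha> r (c t))) = path_tuple \<alpha> r (c (Suc t))" for t
      proof
        fix i
        show "eval_nilpotent ?H (F i) (path_tuple \<alpha> r (c t)) = path_tuple \<alpha> r (c (Suc t)) i"
          unfolding path_tuple_def[of _ _ _ i]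
          by (subst eval_nilpotent_path_tuple[OF \<alpha> coeff], assumption, rule mat_op_cong)
             (simp add: path_mat_def c_def F\<alpha> algebra_simps)
      qed
      have X: "path_tuple \<alpha> r (c t) \<in> domain_Dfm_nil ?H f m" for t
      proof (induction t)
        case 0
        then show ?case
          using X0 nilpotent_path_tuple[OF \<alpha>] by (simp add: domain_Dfm_nil_def c_def)
      next
        case (Suc t)
        then have "(\<lambda>i. eval_nilpotent ?H (F i) (path_tuple \<alpha> r (c t))) \<in> domain_Dfm_nil ?H f m"
          by (rule subsetD[OF self_map[OF hilbert_space_coord_space] imageI])
        then show ?case unfolding step .
      qed
      have bound: "f [i] * (cmod (a i \<alpha> * complex_of_real (r ^ length \<alpha>)))\<^sup>2 * (real t)\<^sup>2 \<le> 1" for t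
      proof -
        let ?W = "path_mat \<alpha> r (c t)"
        \<comment> \<open>In row \<open>0\<close> the shift part sits in column \<open>1\<close>,
          which differs from \<open>length \<alpha>\<close>, so the corner holds the perturbation
          alone.\<close>
        have "?W [i] 0 (length \<alpha>) = c t i"
          using \<alpha> by (auto simp: path_mat_def)
        then have "(cmod (c t i))\<^sup>2 \<le> (\<Sum>p<?d. (cmod (?W [i] 0 p))\<^sup>2)"
          using member_le_sum[of "length \<alpha>" "{..<?d}" "\<lambda>p. (cmod (?W [i] 0 p))\<^sup>2"] by simp
        then have "f [i] * (cmod (c t i))\<^sup>2 \<le> f [i] * (\<Sum>p<?d. (cmod (?W [i] 0 p))\<^sup>2)"
          by (rule mult_left_mono[OF _ f_nonneg])
        also have "\<dots> \<le> 1"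
        proof (rule domain_row_bound[OF word_op_path_tuple[OF \<alpha>] path_mat_long[OF \<alpha>] f_nonneg m])
          show "path_tuple \<alpha> r (c t) \<in> domain_Dfm ?H f m"
            using X[of t] by (simp only: domain_Dfm_nil_def mem_Collect_eq)
        qed simp_all
        finally show ?thesis
          by (simp add: c_def norm_mult power_mult_distrib mult_ac)
      qed
      have "cmod (a i \<alpha> * complex_of_real (r ^ length \<alpha>)) = 0"
      proof (rule ccontr)
        define e where "e = f [i] * (cmod (a i \<alpha> * complex_of_real (r ^ length \<alpha>)))\<^sup>2"
        assume "cmod (a i \<alpha> * complex_of_real (r ^ length \<alpha>)) \<noteq> 0"
        then have "0 < e" using f_pos[of i] unfolding e_def by (intro mult_pos_pos) auto
        \<comment> \<open>A linear lower bound suffices, because a natural number is at most its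
          square.\<close>
        then obtain t where t: "1 < real t * e"
          using reals_Archimedean3 by blast
        then have "real t * e \<le> e * (real t)\<^sup>2"
          using \<open>0 < e\<close> by (cases t) (auto simp: power2_eq_square algebra_simps)
        with t bound[of t] show False by (simp add: e_def)
      qed
      then show ?thesis using r by simp
    qed (rule a)
  qed
  then show ?thesis by (auto simp: F fun_eq_iff)
qed

end
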